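(* For each $\epsilon \in (1/2, 1]$, there exists a $(1-\epsilon)$-large set $S \subset \mathbb{R}$ that does not contain any affine copy of $\{2^n\}$.
   Context: $|A|$ denotes the Lebesgue measure of a measurable set $A \subseteq \mathbb{R}$. For $\epsilon \in (0,1]$, a $(1-\epsilon)$-large set is a Lebesgue measurable set $S \subseteq \mathbb{R}$ such that $|S \cap I| \geq 1-\epsilon$ for every interval $I \subset \mathbb{R}$ of unit length. An affine copy of $\{2^n\}$ is a set of the form $\{x 2^n + t : n \in \mathbb{N}\}$ with $x \in \mathbb{R} \setminus \{0\}$ and $t \in \mathbb{R}$. *)

theory Defs
  imports "HOL-Analysis.Analysis"
begin

text \<open>The intervals \<open>I\<close> range over all (open, closed, half-open) intervals of the real line; their
  length is their Lebesgue measure. Note that \<open>measure\<close> is 0 on sets of infinite measure, so the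
  condition \<open>measure lebesgue I = 1\<close> excludes unbounded intervals.
  The parameter \<open>\<delta>\<close> corresponds to \<open>1 - \<epsilon>\<close>.\<close>

definition large_set :: "real \<Rightarrow> real set \<Rightarrow> bool" where
  "large_set \<delta> S \<longleftrightarrow> S \<in> sets lebesgue \<and>
     (\<forall>I. is_interval I \<and> measure lebesgue I = 1 \<longrightarrow> measure lebesgue (S \<inter> I) \<ge> \<delta>)"

text \<open>The index \<open>n\<close> starts at 0. As all nonzero scalings \<open>x\<close> are allowed, starting at 1 would yield the
  same family of sets.\<close>

definition affine_copy_powers_of_2 :: "real set \<Rightarrow> bool" where
  "affine_copy_powers_of_2 A \<longleftrightarrow> (\<exists>x t. x \<noteq> 0 \<and> A = {x * 2 ^ n + t | n :: nat. True})"

end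

theory Submission
  imports Defs
begin

text \<open>
  The set has the form \<open>S = {y. frac (\<phi> \<lfloor>y\<rfloor> * y) < 1/2}\<close>, where the
  frequency \<open>\<phi>\<close> is at least a large constant \<open>c\<close>. Since the condition selects half of every
  period, \<open>S\<close> has density almost \<open>1/2\<close> in every unit interval, whatever \<open>\<phi>\<close> is; this is
  \<open>modulated_set_large\<close>. The work lies in choosing \<open>\<phi>\<close> so that \<open>S\<close> contains no sequence
  \<open>x * 2 ^ n + t\<close>.

  Where \<open>\<phi>\<close> takes a constant value \<open>F\<close>, the phases of consecutive terms are a translate of a
  doubling orbit \<open>z\<close>, \<open>2 z\<close>, \<open>4 z\<close>, \<open>8 z\<close> modulo \<open>1\<close>, and the terms lie in \<open>S\<close> only if this
  translate fits into the half circle \<open>[0, 1/2)\<close>. If \<open>z\<close> is close to \<open>1/5\<close> modulo \<open>1\<close>, the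
  orbit runs close to all nonzero multiples of \<open>1/5\<close>, and no half circle contains it
  (\<open>doubling_orbit_leaves_half_circle\<close>). The translation \<open>t\<close> is harmless, as it only rotates
  the orbit.

  It remains to arrange that for each \<open>x\<close> some window has \<open>z\<close> close to \<open>1/5\<close>. A sequence of
  windows \<open>64 ^ i \<le> \<bar>y\<bar> < 64 ^ (i + 1)\<close> would let an adversary choose fresh binary digits of
  \<open>x\<close> for each window, were the frequencies comparable. Within a block of windows the frequency
  is therefore divided by about \<open>64\<close> from each window to the next, so that all windows of the
  block see the same digits of \<open>x\<close>. Small additional changes of the frequency make the values of
  \<open>z\<close> run through an arithmetic progression \<open>a + j * s\<close> with a small step \<open>s\<close> and a total
  length of at least \<open>1\<close>. Such a progression comes close to \<open>1/5\<close> modulo \<open>1\<close>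
  (\<open>progression_hits_mod_1\<close>). The blocks repeat for ever, so that one of them lies beyond the size of
  any given \<open>x\<close> and \<open>t\<close>; there the sequence leaves \<open>S\<close> (\<open>ladder_avoids_powers\<close>).
\<close>

section \<open>Density of a set with locally constant frequency\<close>

text \<open>Since the frequency depends on \<open>\<lfloor>y\<rfloor>\<close> only, at most two frequencies occur on a half-open unit interval.\<close>

definition modulated_set :: "(int \<Rightarrow> real) \<Rightarrow> real set" where
  "modulated_set \<phi> = {y. frac (\<phi> \<lfloor>y\<rfloor> * y) < 1/2}"

lemma modulated_set_borel: "modulated_set \<phi> \<in> sets borel"
proof -
  have eq: "modulated_set \<phi> = (\<Union>n. {of_int n..<of_int n + 1} \<inter> {y. \<phi> n * y - of_int \<lfloor>\<phi> n * y\<rfloor> < 1/2})"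
  proof (rule set_eqI)
    fix y :: real
    have "y \<in> {of_int n..<of_int n + 1} \<longleftrightarrow> n = \<lfloor>y\<rfloor>" for n
      by (auto simp: floor_eq_iff eq_commute[of n])
    then show "y \<in> modulated_set \<phi> \<longleftrightarrow>
        y \<in> (\<Union>n. {of_int n..<of_int n + 1} \<inter> {y. \<phi> n * y - of_int \<lfloor>\<phi> n * y\<rfloor> < 1/2})"
      by (simp only: modulated_set_def frac_def UN_iff Int_iff mem_Collect_eq) simp
  qed
  show ?thesis
    unfolding eq by measurable
qed

text \<open>Each of the at least \<open>F * (q - p) - 2\<close> full periods inside the interval contributes \<open>1 / (2 * F)\<close>.\<close>

lemma half_wave_measure_ge:
  fixes F p q :: real
  assumes "F > 0"
  shows "measure lebesgue ({y. frac (F * y) < 1/2} \<inter> {p<..<q}) \<ge> (q - p) / 2 - 1 / F"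
proof -
  \<comment> \<open>\<open>K\<close> indexes full periods \<open>[k / F, (k + 1) / F)\<close> inside the interval, \<open>J k\<close> is the first half of a period.\<close>
  define K where "K = {\<lfloor>F * p\<rfloor> + 1..<\<lfloor>F * q\<rfloor>}"
  define J where "J k = {of_int k / F..<(of_int k + 1/2) / F}" for k :: int
  let ?H = "{y. frac (F * y) < 1/2} \<inter> {p<..<q}"
  have J_floor: "\<lfloor>F * y\<rfloor> = k \<and> frac (F * y) < 1/2" if "y \<in> J k" for y k
  proof -
    have "of_int k \<le> F * y" "F * y < of_int k + 1/2"
      using that assms by (auto simp: J_def field_simps)
    moreover from this have "\<lfloor>F * y\<rfloor> = k" by (intro floor_unique) auto
    ultimately show ?thesis by (auto simp: frac_def)
  qed
  have J_sub: "J k \<subseteq> ?H" if "k \<in> K" for k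
  proof
    fix y assume y: "y \<in> J k"
    have "F * p < of_int k" "of_int k + 1 \<le> F * q"
      using that unfolding K_def by (simp_all add: floor_less_iff less_floor_iff) linarith+
    moreover have "of_int k \<le> F * y" "F * y < of_int k + 1/2"
      using y assms by (auto simp: J_def field_simps)
    ultimately have "F * p < F * y" "F * y < F * q" by linarith+
    with assms J_floor[OF y] show "y \<in> ?H" by simp
  qed
  have J_meas: "measure lebesgue (J k) = 1 / (2 * F)" for k
    using assms by (simp add: J_def field_simps)
  have H_meas: "?H \<in> lmeasurable"
  proof (rule bounded_set_imp_lmeasurable)
    have "{y. F * y - of_int \<lfloor>F * y\<rfloor> < 1/2} \<in> sets borel" by measurable
    then show "?H \<in> sets lebesgue" by (auto simp: frac_def)
  qed (auto intro: bounded_subset[OF bounded_Ioo])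
  have "real (card K) \<ge> F * q - F * p - 2"
    unfolding K_def by simp linarith
  then have "(F * q - F * p - 2) * (1 / (2 * F)) \<le> card K * (1 / (2 * F))"
    using assms by (intro mult_right_mono) auto
  moreover have "(F * q - F * p - 2) * (1 / (2 * F)) = (q - p) / 2 - 1 / F"
    using assms by (simp add: field_simps)
  ultimately have "(q - p) / 2 - 1 / F \<le> card K * (1 / (2 * F))"
    by simp
  also have "\<dots> = (\<Sum>k\<in>K. measure lebesgue (J k))"
    by (simp add: J_meas)
  also have "\<dots> = measure lebesgue (\<Union>k\<in>K. J k)"
  proof (rule measure_finite_Union[symmetric])
    show "disjoint_family_on J K"
      unfolding disjoint_family_on_def using J_floor by blast
    show "emeasure lebesgue (J k) \<noteq> \<infinity>" for k
      unfolding J_def by (cases "of_int k / F \<le> (of_int k + 1/2) / F") auto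
  qed (auto simp: K_def J_def)
  also have "\<dots> \<le> measure lebesgue ?H"
  proof (rule measure_mono_fmeasurable)
    show "(\<Union>k\<in>K. J k) \<subseteq> ?H" using J_sub by blast
    show "(\<Union>k\<in>K. J k) \<in> sets lebesgue"
      by (intro sets.finite_UN) (auto simp: K_def J_def)
  qed (rule H_meas)
  finally show ?thesis .
qed

lemma modulated_set_density:
  assumes "c > 0" and \<phi>: "\<And>n. \<phi> n \<ge> c"
  shows "measure lebesgue (modulated_set \<phi> \<inter> {a<..<a + 1}) \<ge> 1/2 - 2 / c"
proof -
  define n where "n = \<lfloor>a\<rfloor>"
  define b :: real where "b = of_int n + 1"
  have ab: "of_int n \<le> a" "a < b" "b \<le> a + 1"
    unfolding n_def b_def by linarith+
  let ?H = "\<lambda>n. {y. frac (\<phi> n * y) < 1/2}"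
  have S: "modulated_set \<phi> \<in> sets lebesgue"
    using modulated_set_borel by simp
  have left: "?H n \<inter> {a<..<b} = modulated_set \<phi> \<inter> {a<..<b}"
  proof -
    have "\<lfloor>y\<rfloor> = n" if "y \<in> {a<..<b}" for y
      using that ab by (intro floor_unique) (auto simp: b_def)
    then show ?thesis by (auto simp: modulated_set_def)
  qed
  have right: "?H (n + 1) \<inter> {b<..<a + 1} = modulated_set \<phi> \<inter> {b<..<a + 1}"
  proof -
    have "\<lfloor>y\<rfloor> = n + 1" if "y \<in> {b<..<a + 1}" for y
      using that ab by (intro floor_unique) (auto simp: b_def)
    then show ?thesis by (auto simp: modulated_set_def)
  qed
  have fin: "modulated_set \<phi> \<inter> {p<..<q} \<in> lmeasurable" for p q
    using S by (intro bounded_set_imp_lmeasurable) (auto intro: bounded_subset[OF bounded_Ioo])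
  have inv: "1 / \<phi> m \<le> 1 / c" for m
    using assms(1) \<phi>[of m] by (intro divide_left_mono) auto
  have pos: "\<phi> m > 0" for m using assms(1) \<phi>[of m] by linarith
  have "1/2 - 2 / c \<le> ((b - a) / 2 - 1 / \<phi> n) + ((a + 1 - b) / 2 - 1 / \<phi> (n + 1))"
    using inv[of n] inv[of "n + 1"] by (simp add: field_simps)
  also have "\<dots> \<le> measure lebesgue (modulated_set \<phi> \<inter> {a<..<b})
                + measure lebesgue (modulated_set \<phi> \<inter> {b<..<a + 1})"
    using half_wave_measure_ge[OF pos[of "n + 1"], where p = b and q = "a + 1"]
      half_wave_measure_ge[OF pos[of n], where p = a and q = b]
    unfolding left right by linarith
  also have "\<dots> = measure lebesgue ((modulated_set \<phi> \<inter> {a<..<b}) \<union> (modulated_set \<phi> \<inter> {b<..<a + 1}))"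
    using fin by (intro measure_Un_AE[symmetric]) auto
  also have "\<dots> \<le> measure lebesgue (modulated_set \<phi> \<inter> {a<..<a + 1})"
    using ab fin by (intro measure_mono_fmeasurable) auto
  finally show ?thesis .
qed

text \<open>Two points of \<open>I\<close> are at most \<open>1\<close> apart, since \<open>I\<close> contains the segment between them; so
  \<open>I\<close> is bounded, and its measure forces \<open>Sup I - Inf I \<ge> 1\<close>.\<close>

lemma unit_interval_contains_open:
  fixes I :: "real set"
  assumes I: "is_interval I" and m: "measure lebesgue I = 1"
  shows "I \<in> lmeasurable" "\<exists>a. {a<..<a + 1} \<subseteq> I"
proof -
  have meas: "I \<in> sets lebesgue"
  proof -
    have "I \<inter> cball 0 (real n) \<in> lmeasurable" for n :: nat
      using I by (intro measurable_convex) (auto simp: is_interval_convex convex_Int bounded_Int)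
    then have "(\<Union>n::nat. I \<inter> cball 0 (real n)) \<in> sets lebesgue" by blast
    also have "(\<Union>n::nat. I \<inter> cball 0 (real n)) = I"
      using real_arch_simple by (auto simp: dist_norm)
    finally show ?thesis .
  qed
  show lm: "I \<in> lmeasurable"
    using m meas by (metis fmeasurableI measure_zero_top top.not_eq_extremum zero_neq_one
        infinity_ennreal_def)
  have ne: "I \<noteq> {}" using m by auto
  have diam: "v \<le> u + 1" if "u \<in> I" "v \<in> I" for u v
  proof (cases "u \<le> v")
    case True
    have "{u..v} \<subseteq> I" using mem_is_interval_1_I[OF I that] by auto
    then have "measure lebesgue {u..v} \<le> 1"
      unfolding m[symmetric] using lm by (intro measure_mono_fmeasurable) auto
    then show ?thesis using True by simp
  qed auto
  obtain w where w: "w \<in> I" using ne by blast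
  have bdd: "bdd_below I" "bdd_above I"
    using diam[OF _ w] diam[OF w] by (auto intro!: bdd_belowI[of _ "w - 1"] bdd_aboveI[of _ "w + 1"] simp: algebra_simps)
  have "I \<subseteq> {Inf I..Sup I}"
    using bdd by (auto intro: cInf_lower cSup_upper)
  then have "measure lebesgue I \<le> measure lebesgue {Inf I..Sup I}"
    using meas by (intro measure_mono_fmeasurable) auto
  moreover have "Inf I \<le> Sup I"
    using w bdd by (meson cInf_lower cSup_upper order_trans)
  ultimately have len: "Inf I + 1 \<le> Sup I"
    using m by simp
  have "y \<in> I" if y: "Inf I < y" "y < Inf I + 1" for y
  proof -
    obtain u where "u \<in> I" "u < y" using y(1) ne bdd by (meson cInf_less_iff)
    moreover have "y < Sup I" using y(2) len by linarith
    then obtain v where "v \<in> I" "y < v" using ne bdd by (meson less_cSup_iff)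
    ultimately show ?thesis using mem_is_interval_1_I[OF I, of u v y] by auto
  qed
  then show "\<exists>a. {a<..<a + 1} \<subseteq> I" by (intro exI[of _ "Inf I"]) auto
qed

lemma modulated_set_large:
  assumes "c > 0" and "\<And>n. \<phi> n \<ge> c" and "\<delta> \<le> 1/2 - 2 / c"
  shows "large_set \<delta> (modulated_set \<phi>)"
  unfolding large_set_def
proof (intro conjI allI impI)
  show S: "modulated_set \<phi> \<in> sets lebesgue"
    using modulated_set_borel by simp
  fix I :: "real set"
  assume "is_interval I \<and> measure lebesgue I = 1"
  then obtain a where lm: "I \<in> lmeasurable" and a: "{a<..<a + 1} \<subseteq> I"
    using unit_interval_contains_open by blast
  have "\<delta> \<le> measure lebesgue (modulated_set \<phi> \<inter> {a<..<a + 1})"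
    using assms(3) modulated_set_density[where \<phi> = \<phi> and a = a, OF assms(1,2)] by linarith
  also have "\<dots> \<le> measure lebesgue (modulated_set \<phi> \<inter> I)"
    using a lm S by (intro measure_mono_fmeasurable) (auto intro: fmeasurable_Int_fmeasurable simp: Int_commute)
  finally show "\<delta> \<le> measure lebesgue (modulated_set \<phi> \<inter> I)" .
qed

section \<open>Doubling orbits that leave every half circle\<close>

text \<open>Modulo \<open>1\<close> the orbit is close to \<open>1/5, 2/5, 4/5, 3/5\<close>. If a rotation moved all four points into
  \<open>[0, 1/2)\<close>, then any two of them that differ by about \<open>1/5\<close> on the circle would do so on the line.
  The steps from \<open>1/5\<close> through \<open>2/5\<close> and \<open>3/5\<close> to \<open>4/5\<close> would then add up to about \<open>3/5\<close>, more than
  the length of \<open>[0, 1/2)\<close>.\<close>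

lemma doubling_orbit_leaves_half_circle:
  fixes z \<theta> :: real
  assumes "\<bar>z - (1/5 + of_int m)\<bar> \<le> 1/200"
  shows "\<exists>r<4. frac (\<theta> + 2 ^ r * z) \<ge> 1/2"
proof (rule ccontr)
  assume "\<not> ?thesis"
  then have *: "frac (\<theta> + 2 ^ r * z) < 1/2" if "r < 4" for r
    using that by force
  define k where "k r = \<lfloor>\<theta> + 2 ^ r * z\<rfloor>" for r :: nat
  define f where "f r = frac (\<theta> + 2 ^ r * z)" for r :: nat
  have f: "0 \<le> f r" "f r < 1/2" if "r < 4" for r
    using *[OF that] by (auto simp: f_def)
  have kf: "\<theta> + 2 ^ r * z = of_int (k r) + f r" for r
    by (simp add: k_def f_def frac_def)
  define e where "e = z - (1/5 + of_int m)"
  have e: "\<bar>e\<bar> \<le> 1/200" and z: "z = 1/5 + of_int m + e"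
    using assms by (auto simp: e_def)
  note bounds = f[of 0] f[of 1] f[of 2] f[of 3]
  note eqs = kf[of 0] kf[of 1] kf[of 2] kf[of 3]
  \<comment> \<open>The index order \<open>0, 1, 3, 2\<close> visits the multiples of \<open>1/5\<close> in increasing order, as \<open>8/5\<close> is \<open>3/5\<close> modulo \<open>1\<close>.\<close>
  have d1: "f 1 - f 0 = 1/5 + e - of_int (k 1 - k 0 - m)"
    using eqs z by simp
  have d2: "f 3 - f 1 = 1/5 + 6 * e - of_int (k 3 - k 1 - 6 * m - 1)"
    using eqs z by simp
  have d3: "f 2 - f 3 = 1/5 - 4 * e - of_int (k 2 - k 3 + 4 * m + 1)"
    using eqs z by simp
  have zero: "i = 0" if "\<bar>real_of_int i\<bar> < 1" for i using that by linarith
  have "k 1 - k 0 - m = 0" using d1 bounds e by (intro zero) linarith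
  moreover have "k 3 - k 1 - 6 * m - 1 = 0" using d2 bounds e by (intro zero) linarith
  moreover have "k 2 - k 3 + 4 * m + 1 = 0" using d3 bounds e by (intro zero) linarith
  ultimately have "f 2 - f 0 = 3/5 + 3 * e" using d1 d2 d3 by simp
  then show False using bounds e by linarith
qed

text \<open>The progression covers a distance of at least \<open>1\<close>, so it passes some \<open>w + m\<close>, in steps of \<open>\<bar>s\<bar>\<close>.\<close>

lemma progression_hits_mod_1:
  fixes a s w :: real and N :: nat
  assumes "1 \<le> N * \<bar>s\<bar>"
  shows "\<exists>j\<le>N. \<exists>m::int. \<bar>a + real j * s - (w + of_int m)\<bar> \<le> \<bar>s\<bar>"
proof -
  have s: "s \<noteq> 0" using assms by auto
  define m where "m = (if s > 0 then \<lceil>a - w\<rceil> else \<lfloor>a - w\<rfloor>)"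
  define q where "q = (w + of_int m - a) / s"
  have "0 \<le> (w + of_int m - a) * sgn s" "(w + of_int m - a) * sgn s \<le> 1"
    using s unfolding m_def sgn_if by (auto; linarith)+
  moreover have q: "q * \<bar>s\<bar> = (w + of_int m - a) * sgn s"
    using s by (simp add: q_def abs_if sgn_if field_simps)
  ultimately have "0 \<le> q * \<bar>s\<bar>" "q * \<bar>s\<bar> \<le> N * \<bar>s\<bar>" using assms by linarith+
  then have q0: "0 \<le> q" "q \<le> N"
    using s by (auto simp: zero_le_mult_iff mult_le_cancel_right)
  define j where "j = nat \<lfloor>q\<rfloor>"
  have j: "real j \<le> q" "q < real j + 1" unfolding j_def using q0 by linarith+
  have "a + real j * s - (w + of_int m) = (real j - q) * s"
    using s by (simp add: q_def field_simps)
  also have "\<bar>\<dots>\<bar> \<le> 1 * \<bar>s\<bar>"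
    unfolding abs_mult using j by (intro mult_right_mono) auto
  finally show ?thesis using j q0 by (intro exI[of _ j] exI[of _ m] conjI) auto
qed

section \<open>Frequencies defeating every affine copy\<close>

text \<open>The progression in a block has steps between \<open>1 / rungs\<close> and \<open>2 / rungs\<close>. The upper bound has to be at
  most \<open>1/200\<close>, the tolerance around \<open>1/5\<close>.\<close>

definition rungs :: nat where
  "rungs = 400"

text \<open>The frequency on the window \<open>64 ^ i \<le> \<bar>\<lfloor>y\<rfloor>\<bar> < 64 ^ (i + 1)\<close>. A block consists of \<open>Suc rungs\<close> windows, and
  \<open>j = i mod Suc rungs\<close> is the position in the block. The first summand compensates the growth of
  \<open>y\<close> along the block. The second one adds the phase \<open>j * s\<close>: on the window, \<open>y / 64 ^ i\<close> has size
  about \<open>1\<close>, whatever the block.\<close>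

definition ladder_freq :: "real \<Rightarrow> nat \<Rightarrow> real" where
  "ladder_freq c i =
     c * 64 ^ (rungs - i mod Suc rungs) + real (i mod Suc rungs) / (2 * real rungs * 64 ^ i)"

text \<open>At \<open>n = 0\<close> the convention \<open>log 64 0 = 0\<close> puts the cell into the window of index \<open>0\<close>.\<close>

definition ladder :: "real \<Rightarrow> int \<Rightarrow> real" where
  "ladder c n = ladder_freq c (nat \<lfloor>log 64 \<bar>real_of_int n\<bar>\<rfloor>)"

lemma ladder_ge:
  assumes "c > 0"
  shows "ladder c n \<ge> c"
proof -
  have "c * 1 \<le> c * 64 ^ k" for k :: nat
    using assms by (intro mult_left_mono) auto
  then show ?thesis
    unfolding ladder_def ladder_freq_def by (simp add: add_increasing2)
qed

lemma ladder_eq: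
  assumes "64 ^ i \<le> \<bar>real_of_int n\<bar>" "\<bar>real_of_int n\<bar> < 64 ^ Suc i"
  shows "ladder c n = ladder_freq c i"
proof -
  have pos: "\<bar>real_of_int n\<bar> > 0"
    using assms(1) by (smt (verit) zero_less_power)
  have "real i \<le> log 64 \<bar>real_of_int n\<bar>"
    using assms(1) pos by (subst le_log_iff) (auto simp: powr_realpow)
  moreover have "log 64 \<bar>real_of_int n\<bar> < real (Suc i)"
    using assms(2) pos by (subst log_less_iff) (auto simp: powr_realpow simp del: of_nat_Suc power_Suc)
  ultimately have "\<lfloor>log 64 \<bar>real_of_int n\<bar>\<rfloor> = int i"
    by (intro floor_unique) auto
  then show ?thesis by (simp add: ladder_def)
qed

text \<open>A term of the sequence in window \<open>j\<close> of a block is \<open>64 ^ j\<close> times the corresponding term \<open>u\<close> in the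
  first window. Its phase is therefore \<open>u\<close> times the right-hand side, which is affine in \<open>j\<close>.\<close>

lemma ladder_freq_scaled:
  assumes "j \<le> rungs"
  shows "ladder_freq c (Suc rungs * k + j) * 64 ^ j =
    c * 64 ^ rungs + real j * (1 / (2 * real rungs * 64 ^ (Suc rungs * k)))"
proof -
  have *: "(Suc rungs * k + j) mod Suc rungs = j"
    using assms by (metis le_imp_less_Suc mod_less mod_mult_self4)
  have "(64::real) ^ (rungs - j) * 64 ^ j = 64 ^ rungs"
    using assms by (subst power_add[symmetric]) (simp only: le_add_diff_inverse2)
  then have "c * (64 ^ (rungs - j) * 64 ^ j) = c * 64 ^ rungs" by (simp only:)
  then show ?thesis
    unfolding ladder_freq_def * by (simp only: distrib_right power_add mult.assoc) simp
qed

lemma dyadic_multiple_in_octave: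
  fixes x P :: real
  assumes "0 < x" "x < 2 * P"
  shows "\<exists>n. 2 * P \<le> x * 2 ^ n \<and> x * 2 ^ n < 4 * P"
proof -
  obtain N where "2 * P / x < 2 ^ N" using real_arch_pow[of 2 "2 * P / x"] by auto
  then have N: "2 * P \<le> x * 2 ^ N" using assms by (simp add: field_simps)
  define n where "n = (LEAST n. 2 * P \<le> x * 2 ^ n)"
  have n: "2 * P \<le> x * 2 ^ n" unfolding n_def using N by (rule LeastI)
  moreover obtain n' where "n = Suc n'" using n assms by (cases n) auto
  moreover from this have "\<not> 2 * P \<le> x * 2 ^ n'"
    unfolding n_def using not_less_Least by (metis lessI)
  ultimately show ?thesis by (intro exI[of _ n]) auto
qed

text \<open>Take a block that starts at some \<open>P\<close> larger than \<open>\<bar>t\<bar> + 1\<close>, and the term \<open>u\<close> of \<open>x * 2 ^ n\<close> in its first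
  window. Along the block the phases of \<open>u * 64 ^ j\<close> form a progression, which meets a neighbourhood
  of \<open>1/5\<close>; in that window one of four consecutive terms leaves the set.\<close>

lemma ladder_avoids_powers:
  assumes "x \<noteq> 0"
  shows "\<exists>n. x * 2 ^ n + t \<notin> modulated_set (ladder c)"
proof -
  obtain k where k: "\<bar>t\<bar> + 1 + \<bar>x\<bar> < 64 ^ k" using real_arch_pow[of 64] by auto
  define P :: real where "P = 64 ^ (Suc rungs * k)"
  have "(64::real) ^ k \<le> P" unfolding P_def by (intro power_increasing) auto
  then have P: "\<bar>t\<bar> + 1 < P" "\<bar>x\<bar> < 2 * P" "P > 0" using k by auto
  \<comment> \<open>Starting at \<open>2 * P\<close> leaves room below for \<open>t\<close> and the rounding in \<open>\<lfloor>y\<rfloor>\<close>; up to \<open>32 * P\<close> after three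
    doublings, there is also room above in the window of ratio \<open>64\<close>.\<close>
  obtain n0 where n0: "2 * P \<le> \<bar>x\<bar> * 2 ^ n0" "\<bar>x\<bar> * 2 ^ n0 < 4 * P"
    using dyadic_multiple_in_octave[of "\<bar>x\<bar>" P] P assms by auto
  define u where "u = x * 2 ^ n0"
  have u: "2 * P \<le> \<bar>u\<bar>" "\<bar>u\<bar> < 4 * P" using n0 by (auto simp: u_def abs_mult)
  define a where "a = c * 64 ^ rungs * u"
  define s where "s = u / (2 * real rungs * P)"
  have s: "1 \<le> real rungs * \<bar>s\<bar>" "\<bar>s\<bar> \<le> 1/200"
    using u P(3) by (auto simp: s_def rungs_def field_simps)
  obtain j m where j: "j \<le> rungs" and m: "\<bar>a + real j * s - (1/5 + of_int m)\<bar> \<le> \<bar>s\<bar>"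
    using progression_hits_mod_1[of rungs s a "1/5"] s(1) by auto
  define i where "i = Suc rungs * k + j"
  define F where "F = ladder_freq c i"
  define z where "z = F * (u * 64 ^ j)"
  have "z = (F * 64 ^ j) * u" by (simp add: z_def)
  also have "\<dots> = a + real j * s"
    unfolding F_def i_def ladder_freq_scaled[OF j] a_def s_def P_def by (simp only: distrib_right) simp
  finally have "\<bar>z - (1/5 + of_int m)\<bar> \<le> 1/200" using m s(2) by simp
  then obtain r where r: "r < 4" and fr: "frac (F * t + 2 ^ r * z) \<ge> 1/2"
    using doubling_orbit_leaves_half_circle by blast
  define y where "y = x * 2 ^ (n0 + 6 * j + r) + t"
  have "(2::real) ^ (6 * j) = 64 ^ j" by (simp add: power_mult)
  then have yu: "y = u * 64 ^ j * 2 ^ r + t"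
    by (simp add: y_def u_def power_add)
  define W :: real where "W = 64 ^ j"
  have W: "W \<ge> 1" by (simp add: W_def)
  have r2: "1 \<le> (2::real) ^ r" "(2::real) ^ r \<le> 8"
    using r power_increasing[of r 3 "2::real"] by auto
  have PW: "P \<le> P * W" using P W by simp
  have iW: "64 ^ i = P * W" by (simp add: i_def P_def W_def power_add)
  have "\<bar>u\<bar> * W * 2 ^ r \<ge> (2 * P) * W * 1"
    using u W r2 P by (intro mult_mono) auto
  then have lo: "\<bar>u * W * 2 ^ r\<bar> \<ge> 2 * (P * W)" using W by (simp add: abs_mult)
  have "\<bar>u\<bar> * W * 2 ^ r \<le> (4 * P) * W * 8"
    using u W r2 P by (intro mult_mono) auto
  then have hi: "\<bar>u * W * 2 ^ r\<bar> \<le> 32 * (P * W)" using W by (simp add: abs_mult)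
  have fl: "\<bar>real_of_int \<lfloor>y\<rfloor> - u * W * 2 ^ r\<bar> \<le> \<bar>t\<bar> + 1"
    unfolding yu W_def by linarith
  have "64 ^ i \<le> \<bar>real_of_int \<lfloor>y\<rfloor>\<bar>" "\<bar>real_of_int \<lfloor>y\<rfloor>\<bar> < 64 ^ Suc i"
    unfolding power_Suc iW using fl lo hi PW P by linarith+
  then have "ladder c \<lfloor>y\<rfloor> = F" unfolding F_def by (rule ladder_eq)
  moreover have "F * y = F * t + 2 ^ r * z" by (simp add: yu z_def algebra_simps)
  ultimately have "y \<notin> modulated_set (ladder c)"
    using fr by (simp add: modulated_set_def)
  then show ?thesis unfolding y_def by blast
qed

section \<open>Large sets without affine copies of the powers of two\<close>

theorem corollary1p9:
  fixes \<epsilon> :: real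
  assumes "\<epsilon> \<in> {1/2<..1}"
  shows "\<exists>S :: real set. large_set (1 - \<epsilon>) S \<and> \<not> (\<exists>A. affine_copy_powers_of_2 A \<and> A \<subseteq> S)"
proof (intro exI conjI)
  \<comment> \<open>The density bound \<open>1/2 - 2 / c\<close> becomes \<open>1 - \<epsilon>\<close>.\<close>
  define c where "c = 2 / (\<epsilon> - 1/2)"
  have c: "c > 0" "2 / c = \<epsilon> - 1/2"
    using assms by (auto simp: c_def)
  show "large_set (1 - \<epsilon>) (modulated_set (ladder c))"
    using c ladder_ge by (intro modulated_set_large[of c]) auto
  show "\<not> (\<exists>A. affine_copy_powers_of_2 A \<and> A \<subseteq> modulated_set (ladder c))"
    using ladder_avoids_powers unfolding affine_copy_powers_of_2_def by blast
qed

end
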